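(* Fix $q>1$, $y\in\mathbb{R}$ and $\rho\in\mathbb{R}$. Let $\mathcal{R}_q=\{1,1/q,1/q^2,\dots,1/q^n,\dots\}\cup\{0\}$. Consider the problem of finding a probability measure $\mu$ on $\mathbb{R}$ (with finite moments of all orders) such that $$\int H_n(x|q)\,\mu(dx)=\rho^nH_n(y|q),\qquad n=1,2,\dots.\qquad(\ast)$$ (i) If $\rho^2\notin\mathcal{R}_q$, then there is no probability measure $\mu$ satisfying $(\ast)$. (ii) If $\rho^2\in\mathcal{R}_q$ is non-zero, then the probability measure $\mu$ satisfying $(\ast)$ exists, and it is a discrete measure supported on $1+\log_q(1/\rho^2)$ points.
   Context: Notation: $[n]_q=1+q+\dots+q^{n-1}$, $[0]_q=0$. The (renormalized) continuous $q$-Hermite polynomials $H_n(x|q)$ are defined by $H_{-1}=0$, $H_0=1$ and $H_{n+1}(x)=xH_n(x)-[n]_qH_{n-1}(x)$ for $n\ge0$. *)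

theory Defs
  imports "HOL-Probability.Probability"
begin

definition q_number :: "real \<Rightarrow> nat \<Rightarrow> real" where
  "q_number q n = (\<Sum>k<n. q ^ k)"

(* The recurrence H_{n+1} = x H_n - [n]_q H_{n-1} starts from H_{-1} = 0 and H_0 = 1;
   its instance n = 0 is H_1 = x, so the index -1 is not needed. *)
fun q_hermite :: "real \<Rightarrow> nat \<Rightarrow> real \<Rightarrow> real" where
  "q_hermite q 0 x = 1"
| "q_hermite q (Suc 0) x = x"
| "q_hermite q (Suc (Suc n)) x =
     x * q_hermite q (Suc n) x - q_number q (Suc n) * q_hermite q n x"

definition R_set :: "real \<Rightarrow> real set" where
  "R_set q = range (\<lambda>n::nat. 1 / q ^ n) \<union> {0}"

(* Integrability of all powers has to be required explicitly, since the Bochner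
   integral of a non-integrable function is 0 by convention. *)
definition q_hermite_moment_solution :: "real \<Rightarrow> real \<Rightarrow> real \<Rightarrow> real measure \<Rightarrow> bool" where
  "q_hermite_moment_solution q y \<rho> \<mu> \<longleftrightarrow>
     real_distribution \<mu> \<and>
     (\<forall>k::nat. integrable \<mu> (\<lambda>x. x ^ k)) \<and>
     (\<forall>n\<ge>1. (\<integral>x. q_hermite q n x \<partial>\<mu>) = \<rho> ^ n * q_hermite q n y)"

(* Every point of the carrying set S is an atom, so S is determined by \<mu>. *)
definition discrete_supported_on :: "real measure \<Rightarrow> real set \<Rightarrow> bool" where
  "discrete_supported_on \<mu> S \<longleftrightarrow>
     finite S \<and> measure \<mu> S = 1 \<and> (\<forall>s\<in>S. measure \<mu> {s} > 0)"

end

(* The moment conditions say exactly that the Al-Salam--Chihara polynomials P_n with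
     P_{n+1} = (x - rho y q^n) P_n - (1 - rho^2 q^(n-1)) [n]_q P_{n-1}
   have integral 0 for n >= 1, and then the three-term recurrence forces orthogonality with
   int P_n^2 = prod_{i<n} (1 - rho^2 q^i) [i+1]_q. If rho^2 is not in R_q, the first factor
   that is not positive is negative, so some square has a negative integral. If rho^2 = 1/q^m,
   then int P_{m+1}^2 = 0, so mu lives on the at most m+1 zeros of P_{m+1}; fewer than m+1 atoms
   would make int f P_{deg f} vanish for the monic f whose zeros are the atoms. Existence comes
   from composing m two-point kernels with rho = q^(-1/2). *)

theory Submission
  imports Defs
begin

section \<open>Al-Salam--Chihara polynomials\<close>

text \<open>The index is shifted by one against the usual form, so that no exponent
  \<open>n - 1\<close> arises: this factor multiplies \<open>P_n\<close> in the recurrence for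
  \<open>P_{n+2}\<close>.\<close>

definition asc_coeff :: "real \<Rightarrow> real \<Rightarrow> nat \<Rightarrow> real" where
  "asc_coeff q \<rho> n = (1 - \<rho>\<^sup>2 * q ^ n) * q_number q (Suc n)"

fun asc_poly :: "real \<Rightarrow> real \<Rightarrow> real \<Rightarrow> nat \<Rightarrow> real poly" where
  "asc_poly q y \<rho> 0 = 1"
| "asc_poly q y \<rho> (Suc 0) = [:- (\<rho> * y), 1:]"
| "asc_poly q y \<rho> (Suc (Suc n)) =
     [:- (\<rho> * y * q ^ Suc n), 1:] * asc_poly q y \<rho> (Suc n)
     - smult (asc_coeff q \<rho> n) (asc_poly q y \<rho> n)"

definition q_fact :: "real \<Rightarrow> nat \<Rightarrow> real" where
  "q_fact q n = (\<Prod>k<n. q_number q (Suc k))"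

lemma q_number_0 [simp]: "q_number q 0 = 0"
  by (simp add: q_number_def)

lemma q_number_1 [simp]: "q_number q (Suc 0) = 1"
  by (simp add: q_number_def)

lemma q_number_add: "q_number q (m + n) = q_number q m + q ^ m * q_number q n"
  by (induction n) (auto simp: q_number_def algebra_simps power_add)

lemma q_number_Suc_pos: "q > 0 \<Longrightarrow> q_number q (Suc n) > 0"
  unfolding q_number_def by (intro sum_pos) auto

lemma q_fact_0 [simp]: "q_fact q 0 = 1"
  by (simp add: q_fact_def)

lemma q_fact_Suc [simp]: "q_fact q (Suc n) = q_number q (Suc n) * q_fact q n"
  by (simp add: q_fact_def)

lemma q_fact_pos: "q > 0 \<Longrightarrow> q_fact q n > 0"
  unfolding q_fact_def by (intro prod_pos) (auto intro: q_number_Suc_pos)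

lemma degree_asc_poly_le: "degree (asc_poly q y \<rho> n) \<le> n"
proof (induction n rule: induct_nat_012)
  case (ge2 n)
  have "degree ([:- (\<rho> * y * q ^ Suc n), 1:] * asc_poly q y \<rho> (Suc n)) \<le> Suc (Suc n)"
    by (rule order_trans[OF degree_mult_le]) (use ge2 in simp)
  moreover have "degree (smult (asc_coeff q \<rho> n) (asc_poly q y \<rho> n)) \<le> Suc (Suc n)"
    by (rule order_trans[OF degree_smult_le]) (use ge2 in simp)
  ultimately show ?case
    unfolding asc_poly.simps by (rule degree_diff_le)
qed auto

lemma coeff_asc_poly_self [simp]: "coeff (asc_poly q y \<rho> n) n = 1"
proof (induction n rule: induct_nat_012)
  case (ge2 n)
  have "coeff (asc_poly q y \<rho> n) (Suc (Suc n)) = 0"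
    "coeff (asc_poly q y \<rho> (Suc n)) (Suc (Suc n)) = 0"
    using degree_asc_poly_le[of q y \<rho>] by (auto intro!: coeff_eq_0 simp: less_Suc_eq_le le_SucI)
  with ge2 show ?case by simp
qed auto

lemma asc_poly_nonzero [simp]: "asc_poly q y \<rho> n \<noteq> 0"
  using coeff_asc_poly_self[of q y \<rho> n] by (metis coeff_0 zero_neq_one)

text \<open>The identity \<open>H\<^sub>n(x) = \<Sum> [n choose k]\<^sub>q \<rho>\<^sup>n\<^sup>-\<^sup>k H\<^sub>n\<^sub>-\<^sub>k(y) P\<^sub>k(x)\<close>; after division by
  \<open>[n]\<^sub>q!\<close> it is a plain convolution, which makes \<open>q\<close>-binomial coefficients unnecessary.
  The key is the splitting \<open>[k + j]\<^sub>q = [k]\<^sub>q + q\<^sup>k [j]\<^sub>q\<close>.\<close>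

lemma convolution_recurrence:
  fixes a p :: "nat \<Rightarrow> real"
  assumes a1: "a 1 = \<rho> * y * a 0"
    and a: "\<And>n. q_number q (Suc (Suc n)) * a (Suc (Suc n)) = \<rho> * y * a (Suc n) - \<rho>\<^sup>2 * a n"
    and p1: "p 1 = (x - \<rho> * y) * p 0"
    and p: "\<And>n. q_number q (Suc (Suc n)) * p (Suc (Suc n)) =
              (x - \<rho> * y * q ^ Suc n) * p (Suc n) - (1 - \<rho>\<^sup>2 * q ^ n) * p n"
  shows "q_number q (Suc (Suc n)) * (\<Sum>k\<le>Suc (Suc n). a (Suc (Suc n) - k) * p k) =
           x * (\<Sum>k\<le>Suc n. a (Suc n - k) * p k) - (\<Sum>k\<le>n. a (n - k) * p k)"
proof -
  let ?N = "q_number q"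
  \<comment> \<open>These \<open>q ^ k\<close>-weighted sums arise once from the recurrence of
    \<open>p\<close> and once from that of \<open>a\<close>, with opposite signs. They cancel up to
    boundary terms, which \<open>a1\<close> and \<open>p1\<close> remove.\<close>
  define S where "S = (\<Sum>k\<le>Suc n. q ^ k * a (Suc n - k) * p k)"
  define T where "T = (\<Sum>k\<le>n. q ^ k * a (n - k) * p k)"
  have "?N (Suc (Suc n)) * (\<Sum>k\<le>Suc (Suc n). a (Suc (Suc n) - k) * p k) =
      (\<Sum>k\<le>Suc (Suc n). a (Suc (Suc n) - k) * (?N k * p k)) +
      (\<Sum>k\<le>Suc (Suc n). q ^ k * (?N (Suc (Suc n) - k) * a (Suc (Suc n) - k)) * p k)"
    unfolding sum_distrib_left sum.distrib[symmetric]
  proof (intro sum.cong refl)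
    fix k assume "k \<in> {..Suc (Suc n)}"
    then have "?N (Suc (Suc n)) = ?N k + q ^ k * ?N (Suc (Suc n) - k)"
      using q_number_add[of q k "Suc (Suc n) - k"] by simp
    then show "?N (Suc (Suc n)) * (a (Suc (Suc n) - k) * p k) =
      a (Suc (Suc n) - k) * (?N k * p k) +
      q ^ k * (?N (Suc (Suc n) - k) * a (Suc (Suc n) - k)) * p k"
      by (simp only:) (simp add: algebra_simps)
  qed
  \<comment> \<open>\<open>[0]_q = 0\<close> kills the term \<open>k = 0\<close> and
    \<open>[1]_q = 1\<close> isolates \<open>k = 1\<close>; the rest, shifted by two, fits the
    recurrence of \<open>p\<close>.\<close>
  also have "(\<Sum>k\<le>Suc (Suc n). a (Suc (Suc n) - k) * (?N k * p k)) =
      a (Suc n) * p 1 + (\<Sum>k\<le>n. a (n - k) * (?N (Suc (Suc k)) * p (Suc (Suc k))))"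
    by (simp add: sum.atMost_Suc_shift del: sum.atMost_Suc)
  also have "(\<Sum>k\<le>n. a (n - k) * (?N (Suc (Suc k)) * p (Suc (Suc k)))) =
      x * (\<Sum>k\<le>n. a (n - k) * p (Suc k)) - \<rho> * y * (\<Sum>k\<le>n. q ^ Suc k * a (n - k) * p (Suc k))
      - (\<Sum>k\<le>n. a (n - k) * p k) + \<rho>\<^sup>2 * T"
    unfolding p T_def sum_distrib_left sum.distrib[symmetric] sum_subtractf[symmetric]
    by (intro sum.cong refl) (simp add: algebra_simps)
  also have "(\<Sum>k\<le>n. a (n - k) * p (Suc k)) = (\<Sum>k\<le>Suc n. a (Suc n - k) * p k) - a (Suc n) * p 0"
    by (simp add: sum.atMost_Suc_shift del: sum.atMost_Suc)
  also have "(\<Sum>k\<le>n. q ^ Suc k * a (n - k) * p (Suc k)) = S - a (Suc n) * p 0"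
    unfolding S_def by (simp add: sum.atMost_Suc_shift del: sum.atMost_Suc)
  \<comment> \<open>The mirror image at the upper end: \<open>k = n + 2\<close> vanishes,
    \<open>k = n + 1\<close> is split off, and the rest fits the recurrence of
    \<open>a\<close>.\<close>
  also have "(\<Sum>k\<le>Suc (Suc n). q ^ k * (?N (Suc (Suc n) - k) * a (Suc (Suc n) - k)) * p k) =
      (\<Sum>k\<le>n. q ^ k * (?N (Suc (Suc (n - k))) * a (Suc (Suc (n - k)))) * p k)
      + q ^ Suc n * a 1 * p (Suc n)"
    by (simp add: Suc_diff_le)
  also have "(\<Sum>k\<le>n. q ^ k * (?N (Suc (Suc (n - k))) * a (Suc (Suc (n - k)))) * p k) =
      \<rho> * y * (\<Sum>k\<le>n. q ^ k * a (Suc n - k) * p k) - \<rho>\<^sup>2 * T"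
    unfolding a T_def sum_distrib_left sum_subtractf[symmetric]
    by (intro sum.cong refl) (simp add: algebra_simps Suc_diff_le)
  also have "(\<Sum>k\<le>n. q ^ k * a (Suc n - k) * p k) = S - q ^ Suc n * a 0 * p (Suc n)"
    unfolding S_def by simp
  finally show ?thesis
    unfolding a1 p1 by (simp add: algebra_simps)
qed

lemma q_hermite_connection:
  assumes "q > 0"
  shows "q_hermite q n x / q_fact q n =
    (\<Sum>k\<le>n. \<rho> ^ (n - k) * q_hermite q (n - k) y / q_fact q (n - k) *
       (poly (asc_poly q y \<rho> k) x / q_fact q k))"
    (is "_ = ?s n")
proof (induction n rule: induct_nat_012)
  case (ge2 n)
  let ?N = "q_number q"
  have pos: "?N (Suc m) \<noteq> 0" "q_fact q m \<noteq> 0" for m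
    using q_number_Suc_pos[OF assms, of m] q_fact_pos[OF assms, of m] by auto
  have "?N (Suc (Suc n)) * ?s (Suc (Suc n)) = x * ?s (Suc n) - ?s n"
  proof (rule convolution_recurrence)
    fix m
    show "?N (Suc (Suc m)) * (\<rho> ^ Suc (Suc m) * q_hermite q (Suc (Suc m)) y / q_fact q (Suc (Suc m)))
      = \<rho> * y * (\<rho> ^ Suc m * q_hermite q (Suc m) y / q_fact q (Suc m))
        - \<rho>\<^sup>2 * (\<rho> ^ m * q_hermite q m y / q_fact q m)"
      using pos by (simp add: field_simps power2_eq_square)
    show "?N (Suc (Suc m)) * (poly (asc_poly q y \<rho> (Suc (Suc m))) x / q_fact q (Suc (Suc m)))
      = (x - \<rho> * y * q ^ Suc m) * (poly (asc_poly q y \<rho> (Suc m)) x / q_fact q (Suc m))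
        - (1 - \<rho>\<^sup>2 * q ^ m) * (poly (asc_poly q y \<rho> m) x / q_fact q m)"
      using pos[of m] pos[of "Suc m"] by (simp add: field_simps asc_coeff_def)
  qed auto
  also have "\<dots> = x * (q_hermite q (Suc n) x / q_fact q (Suc n)) - q_hermite q n x / q_fact q n"
    using ge2 by simp
  also have "\<dots> = ?N (Suc (Suc n)) * (q_hermite q (Suc (Suc n)) x / q_fact q (Suc (Suc n)))"
    using pos[of n] pos[of "Suc n"] by (simp add: field_simps)
  finally show ?case
    by (simp only: mult_left_cancel[OF pos(1)])
qed auto

section \<open>Moment solutions\<close>

lemma integrable_poly:
  fixes M :: "real measure"
  assumes "\<And>k::nat. integrable M (\<lambda>x. x ^ k)"
  shows "integrable M (poly p)"
proof -
  have "poly p = (\<lambda>x. \<Sum>i\<le>degree p. coeff p i * x ^ i)"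
    by (rule ext) (rule poly_altdef)
  moreover have "integrable M (\<lambda>x. \<Sum>i\<le>degree p. coeff p i * x ^ i)"
    using assms by (intro Bochner_Integration.integrable_sum integrable_mult_right) auto
  ultimately show ?thesis by simp
qed

text \<open>Integrating the connection formula and dividing by \<open>q_fact\<close> gives a
  unitriangular system: the term \<open>k = 0\<close> is the prescribed value, and the terms
  \<open>k \<ge> 1\<close> carry the integrals of the \<open>P_k\<close>.\<close>

lemma q_hermite_moments_iff_asc_poly_moments:
  fixes M :: "real measure"
  assumes "prob_space M" "q > 0" and int: "\<And>k::nat. integrable M (\<lambda>x. x ^ k)"
  shows "(\<forall>n\<ge>1. (\<integral>x. q_hermite q n x \<partial>M) = \<rho> ^ n * q_hermite q n y) \<longleftrightarrow>
    (\<forall>n\<ge>1. (\<integral>x. poly (asc_poly q y \<rho> n) x \<partial>M) = 0)"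
    (is "(\<forall>n\<ge>1. ?H n = ?h n) \<longleftrightarrow> (\<forall>n\<ge>1. ?P n = 0)")
proof -
  interpret prob_space M by fact
  let ?F = "q_fact q"
  have pos: "?F n \<noteq> 0" for n
    using q_fact_pos[OF \<open>q > 0\<close>, of n] by simp
  have int': "integrable M (poly p)" for p
    by (rule integrable_poly[OF int])
  have P0: "poly (1 :: real poly) = (\<lambda>_. 1)"
    by auto
  have conn: "?H n / ?F n = ?h n / ?F n +
      (\<Sum>k\<in>{1..n}. ?h (n - k) / ?F (n - k) * (?P k / ?F k))" for n
  proof -
    have "?H n / ?F n = (\<integral>x. q_hermite q n x / ?F n \<partial>M)"
      by (rule integral_divide_zero[symmetric])
    also have "\<dots> = (\<integral>x. (\<Sum>k\<le>n. ?h (n - k) / ?F (n - k) * (poly (asc_poly q y \<rho> k) x / ?F k)) \<partial>M)"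
      by (simp only: q_hermite_connection[OF \<open>q > 0\<close>, where \<rho> = \<rho> and y = y])
    also have "\<dots> = (\<Sum>k\<le>n. ?h (n - k) / ?F (n - k) * (?P k / ?F k))"
      by (subst Bochner_Integration.integral_sum)
         (simp_all only: int' integrable_mult_right integrable_divide integral_mult_right_zero
           integral_divide_zero)
    also have "{..n} = insert 0 {1..n}"
      by auto
    finally show ?thesis
      by (simp add: prob_space P0)
  qed
  show ?thesis
  proof (intro iffI allI impI)
    fix n :: nat assume H: "\<forall>n\<ge>1. ?H n = ?h n" and "n \<ge> 1"
    then show "?P n = 0"
    proof (induction n rule: less_induct)
      case (less n)
      have "(\<Sum>k\<in>{1..n}. ?h (n - k) / ?F (n - k) * (?P k / ?F k)) =
          (\<Sum>k\<in>{n}. ?h (n - k) / ?F (n - k) * (?P k / ?F k))"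
        using less by (intro sum.mono_neutral_right) auto
      with conn[of n] less.prems pos[of n] show ?case by simp
    qed
  next
    fix n :: nat assume "\<forall>n\<ge>1. ?P n = 0" "n \<ge> 1"
    with conn[of n] pos[of n] show "?H n = ?h n" by simp
  qed
qed

text \<open>The value that the recurrence forces on the integral of \<open>P_n^2\<close>, written
  without a measure so that its sign can be read off from \<open>q\<close> and
  \<open>\<rho>\<close>.\<close>

definition asc_norm :: "real \<Rightarrow> real \<Rightarrow> nat \<Rightarrow> real" where
  "asc_norm q \<rho> n = (\<Prod>i<n. asc_coeff q \<rho> i)"

locale asc_moments = prob_space M for M :: "real measure" +
  fixes q y \<rho> :: real
  assumes integrable_power: "integrable M (\<lambda>x. x ^ k)"
    and moment_asc_poly: "n \<ge> 1 \<Longrightarrow> (\<integral>x. poly (asc_poly q y \<rho> n) x \<partial>M) = 0"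
begin

abbreviation "P \<equiv> asc_poly q y \<rho>"

lemma integrable_poly [simp]: "integrable M (poly p)"
  using integrable_power by (rule integrable_poly)

lemma integrable_power_poly [simp]: "integrable M (\<lambda>x. x ^ k * poly p x)"
proof -
  have "(\<lambda>x. x ^ k * poly p x) = poly (monom 1 k * p)"
    by (auto simp: poly_monom)
  then show ?thesis by (simp only: integrable_poly)
qed

lemma moment_power_asc_poly:
  "(\<integral>x. x ^ Suc k * poly (P (Suc n)) x \<partial>M) =
    (\<integral>x. x ^ k * poly (P (Suc (Suc n))) x \<partial>M)
    + \<rho> * y * q ^ Suc n * (\<integral>x. x ^ k * poly (P (Suc n)) x \<partial>M)
    + asc_coeff q \<rho> n * (\<integral>x. x ^ k * poly (P n) x \<partial>M)"
proof -
  have "x ^ Suc k * poly (P (Suc n)) x = x ^ k * poly (P (Suc (Suc n))) x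
    + \<rho> * y * q ^ Suc n * (x ^ k * poly (P (Suc n)) x)
    + asc_coeff q \<rho> n * (x ^ k * poly (P n) x)" for x
    by (simp add: algebra_simps)
  then show ?thesis
    by (simp only: Bochner_Integration.integral_add integrable_power_poly
        Bochner_Integration.integrable_add integrable_mult_right integral_mult_right_zero)
qed

text \<open>Each use of the recurrence lowers the power by one. Of the three resulting indices only
  the lowest can meet the diagonal, and it contributes the next factor of
  \<open>asc_norm\<close>.\<close>

lemma moment_power_asc_poly_le:
  "k \<le> n \<Longrightarrow> (\<integral>x. x ^ k * poly (P n) x \<partial>M) = (if k = n then asc_norm q \<rho> n else 0)"
proof (induction k arbitrary: n)
  case 0
  then show ?case
    using moment_asc_poly[of n] by (cases "n = 0") (auto simp: asc_norm_def prob_space)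
next
  case (Suc k)
  then obtain m where n: "n = Suc m" "k \<le> m"
    by (cases n) auto
  show ?case
    unfolding n(1) moment_power_asc_poly
    using n(2) Suc.IH[of m] Suc.IH[of "Suc m"] Suc.IH[of "Suc (Suc m)"]
    by (auto simp: asc_norm_def)
qed

text \<open>Serves two choices of \<open>f\<close>: \<open>P_n\<close> itself, for the norm, and the
  monic polynomial vanishing on a finite carrier, for the count of atoms.\<close>

lemma moment_poly_asc_poly:
  assumes "degree f \<le> n"
  shows "(\<integral>x. poly f x * poly (P n) x \<partial>M) = coeff f n * asc_norm q \<rho> n"
proof -
  have f: "poly f x = (\<Sum>i\<le>n. coeff f i * x ^ i)" for x
    by (subst (1) poly_as_sum_of_monoms'[OF assms, symmetric]) (simp add: poly_sum poly_monom)
  have "(\<integral>x. poly f x * poly (P n) x \<partial>M) =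
      (\<integral>x. (\<Sum>i\<le>n. coeff f i * (x ^ i * poly (P n) x)) \<partial>M)"
    by (intro Bochner_Integration.integral_cong)
       (simp_all add: f sum_distrib_left sum_distrib_right mult_ac)
  also have "\<dots> = (\<Sum>i\<le>n. coeff f i * (\<integral>x. x ^ i * poly (P n) x \<partial>M))"
    by (simp add: Bochner_Integration.integral_sum)
  also have "\<dots> = (\<Sum>i\<in>{n}. coeff f i * (\<integral>x. x ^ i * poly (P n) x \<partial>M))"
    by (intro sum.mono_neutral_right) (auto simp: moment_power_asc_poly_le)
  finally show ?thesis
    by (simp add: moment_power_asc_poly_le)
qed

lemma moment_asc_poly_square: "(\<integral>x. (poly (P n) x)\<^sup>2 \<partial>M) = asc_norm q \<rho> n"
  using moment_poly_asc_poly[OF degree_asc_poly_le[of q y \<rho> n]] by (simp add: power2_eq_square)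

lemma asc_norm_nonneg: "asc_norm q \<rho> n \<ge> 0"
  by (simp flip: moment_asc_poly_square)

lemma AE_asc_poly_zero:
  assumes "asc_norm q \<rho> n = 0"
  shows "AE x in M. poly (P n) x = 0"
proof -
  have "integrable M (\<lambda>x. (poly (P n) x)\<^sup>2)"
    using integrable_poly[of "P n * P n"] by (simp add: poly_mult[abs_def] power2_eq_square)
  then have "AE x in M. (poly (P n) x)\<^sup>2 = 0"
    using moment_asc_poly_square[of n] assms
      integral_nonneg_eq_0_iff_AE[of M "\<lambda>x. (poly (P n) x)\<^sup>2"] by simp
  then show ?thesis by simp
qed

lemma card_carrier_ge:
  assumes "finite S" "AE x in M. x \<in> S" and "\<And>i. i < n \<Longrightarrow> asc_norm q \<rho> i \<noteq> 0"
  shows "card S \<ge> n"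
proof (rule ccontr)
  assume less: "\<not> card S \<ge> n"
  \<comment> \<open>Being monic of degree \<open>card S\<close>, \<open>f\<close> has integral
    \<open>asc_norm q \<rho> (card S)\<close> against \<open>P_{card S}\<close>; vanishing on
    \<open>S\<close> makes that integral zero.\<close>
  define f where "f = (\<Prod>s\<in>S. [:- s, 1:])"
  have deg: "degree f = card S"
    unfolding f_def by (simp add: degree_prod_sum_eq)
  have "lead_coeff f = 1"
    unfolding f_def lead_coeff_prod by simp
  then have "coeff f (card S) = 1"
    using deg by simp
  have "AE x in M. poly f x * poly (P (card S)) x = 0"
    using assms(2) by eventually_elim (auto simp: f_def poly_prod \<open>finite S\<close>)
  then have "(\<integral>x. poly f x * poly (P (card S)) x \<partial>M) = 0"
    by (rule integral_eq_zero_AE)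
  with moment_poly_asc_poly[of f "card S"] deg \<open>coeff f (card S) = 1\<close> assms(3)[of "card S"] less
  show False by simp
qed

end

lemma q_hermite_moment_solution_iff:
  assumes "q > 0"
  shows "q_hermite_moment_solution q y \<rho> M \<longleftrightarrow> real_distribution M \<and> asc_moments M q y \<rho>"
proof -
  have "prob_space M" if "real_distribution M"
    using that by (simp add: real_distribution_def)
  then show ?thesis
    using q_hermite_moments_iff_asc_poly_moments[OF _ assms, of M \<rho> y]
    by (auto simp: q_hermite_moment_solution_def asc_moments_def asc_moments_axioms_def)
qed

section \<open>Uniqueness: equal polynomial integrals and a finite carrier\<close>

lemma asc_moments_integral_unique:
  assumes "asc_moments M q y \<rho>" "asc_moments N q y \<rho>"
  shows "(\<integral>x. poly f x \<partial>M) = (\<integral>x. poly f x \<partial>N)"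
proof -
  interpret M: asc_moments M q y \<rho> by fact
  interpret N: asc_moments N q y \<rho> by fact
  \<comment> \<open>The recurrence trades a power of \<open>x\<close> for a change of index, so
    \<open>k = 0\<close> determines all these integrals; \<open>n = 0\<close> then yields the plain
    moments.\<close>
  have "(\<integral>x. x ^ k * poly (asc_poly q y \<rho> n) x \<partial>M) =
      (\<integral>x. x ^ k * poly (asc_poly q y \<rho> n) x \<partial>N)" for k n
  proof (induction k arbitrary: n)
    case 0
    then show ?case
      using M.moment_asc_poly[of n] N.moment_asc_poly[of n]
      by (cases "n = 0") (auto simp: M.prob_space N.prob_space)
  next
    case (Suc k)
    show ?case
    proof (cases n)
      case 0
      have "x ^ Suc k * poly (asc_poly q y \<rho> 0) x =
          x ^ k * poly (asc_poly q y \<rho> 1) x + \<rho> * y * (x ^ k * poly (asc_poly q y \<rho> 0) x)" for x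
        by (simp add: algebra_simps)
      then show ?thesis
        unfolding 0
        by (simp only: Bochner_Integration.integral_add M.integrable_power_poly
            N.integrable_power_poly integrable_mult_right integral_mult_right_zero Suc.IH)
    next
      case (Suc m)
      then show ?thesis
        by (simp only: M.moment_power_asc_poly N.moment_power_asc_poly Suc.IH)
    qed
  qed
  from this[of _ 0] have "(\<integral>x. x ^ k \<partial>M) = (\<integral>x. x ^ k \<partial>N)" for k
    by simp
  then show ?thesis
    by (simp add: poly_altdef M.integrable_power N.integrable_power)
qed

text \<open>The Lagrange basis polynomial of a point of \<open>Z\<close> integrates to the mass of
  that point, so polynomial integrals determine all masses.\<close>

lemma real_distribution_eqI_finite:
  assumes "real_distribution M" "real_distribution N" "finite Z"
    and "AE x in M. x \<in> Z" "AE x in N. x \<in> Z"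
    and eq: "\<And>f. (\<integral>x. poly f x \<partial>M) = (\<integral>x. poly f x \<partial>N)"
  shows "M = N"
proof -
  interpret M: real_distribution M by fact
  interpret N: real_distribution N by fact
  have *: "measure L {z} = (\<integral>x. poly f x \<partial>L)"
    if "real_distribution L" "AE x in L. x \<in> Z" "z \<in> Z"
      and f: "\<And>x. x \<in> Z \<Longrightarrow> poly f x = (if x = z then 1 else 0)" for L z and f :: "real poly"
  proof -
    interpret L: real_distribution L by fact
    have "(\<integral>x. poly f x \<partial>L) = (\<integral>x. indicator {z} x \<partial>L)"
    proof (rule integral_cong_AE)
      show "poly f \<in> borel_measurable L"
        using borel_measurable_continuous_onI[of "poly f"]
        by (simp add: measurable_cong_sets[OF L.events_eq_borel refl] continuous_on_poly continuous_on_id)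
      show "AE x in L. poly f x = indicator {z} x"
        using that(2) by eventually_elim (auto simp: f)
    qed auto
    then show ?thesis by simp
  qed
  have atom: "measure M {z} = measure N {z}" if "z \<in> Z" for z
  proof -
    define g where "g = (\<Prod>s\<in>Z - {z}. [:- s, 1:])"
    define f where "f = smult (1 / poly g z) g"
    have "poly g z \<noteq> 0"
      using assms(3) by (auto simp: g_def poly_prod)
    then have "poly f x = (if x = z then 1 else 0)" if "x \<in> Z" for x
      using that assms(3) by (auto simp: f_def g_def poly_prod)
    then show ?thesis
      using *[OF assms(1,4) \<open>z \<in> Z\<close>, of f] *[OF assms(2,5) \<open>z \<in> Z\<close>, of f] eq[of f] by simp
  qed
  have meas: "measure L A = (\<Sum>z\<in>A \<inter> Z. measure L {z})"
    if "real_distribution L" "AE x in L. x \<in> Z" "A \<in> sets borel" for L A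
  proof -
    interpret L: real_distribution L by fact
    have "finite (A \<inter> Z)"
      using assms(3) by simp
    then have "A \<inter> Z \<in> sets borel"
      by (intro sets.countable[of "A \<inter> Z"]) (auto intro: countable_finite)
    then have "measure L A = measure L (A \<inter> Z)"
      using that by (intro L.finite_measure_eq_AE) auto
    also have "\<dots> = (\<Sum>z\<in>A \<inter> Z. measure L {z})"
      using \<open>finite (A \<inter> Z)\<close> by (intro L.finite_measure_eq_sum_singleton) auto
    finally show ?thesis .
  qed
  show ?thesis
  proof (rule measure_eqI)
    fix A assume "A \<in> sets M"
    then have "A \<in> sets borel"
      by simp
    moreover have "(\<Sum>z\<in>A \<inter> Z. measure M {z}) = (\<Sum>z\<in>A \<inter> Z. measure N {z})"
      by (intro sum.cong refl) (simp add: atom)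
    ultimately have "measure M A = measure N A"
      by (simp only: meas[OF assms(1,4)] meas[OF assms(2,5)])
    then show "emeasure M A = emeasure N A"
      by (simp add: M.emeasure_eq_measure N.emeasure_eq_measure)
  qed simp
qed

section \<open>Existence and nonexistence\<close>

text \<open>The factor \<open>1 - \<rho>^2 q^i\<close> equals \<open>1 - q^(i-m)\<close>, which
  first vanishes at \<open>i = m\<close>.\<close>

lemma asc_norm_degenerate:
  assumes "q > 1" "\<rho>\<^sup>2 = 1 / q ^ m"
  shows "asc_norm q \<rho> (Suc m) = 0" and "n \<le> m \<Longrightarrow> asc_norm q \<rho> n \<noteq> 0"
proof -
  have N: "q_number q (Suc i) \<noteq> 0" for i
    using q_number_Suc_pos[of q i] assms(1) by simp
  show "asc_norm q \<rho> (Suc m) = 0"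
    using assms by (auto simp: asc_norm_def asc_coeff_def)
  have "1 - \<rho>\<^sup>2 * q ^ i \<noteq> 0" if "i < m" for i
    unfolding assms(2) using power_strict_increasing[OF that assms(1)] assms(1) by (simp add: field_simps)
  then show "asc_norm q \<rho> n \<noteq> 0" if "n \<le> m"
    using that N by (auto simp: asc_norm_def asc_coeff_def)
qed

lemma not_asc_moments_if_notin_R_set:
  assumes "q > 1" "\<rho>\<^sup>2 \<notin> R_set q"
  shows "\<not> asc_moments M q y \<rho>"
proof
  assume "asc_moments M q y \<rho>"
  then interpret asc_moments M q y \<rho> .
  have ne: "\<rho>\<^sup>2 * q ^ n \<noteq> 1" for n
    using assms by (auto simp: R_set_def field_simps)
  have "\<rho>\<^sup>2 > 0"
    using assms(2) by (auto simp: R_set_def)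
  then obtain n where "1 / \<rho>\<^sup>2 < q ^ n"
    using real_arch_pow[OF assms(1)] by blast
  with \<open>\<rho>\<^sup>2 > 0\<close> have ex: "\<rho>\<^sup>2 * q ^ n > 1"
    by (simp add: field_simps)
  \<comment> \<open>The first negative coefficient: \<open>asc_norm\<close> at \<open>m + 1\<close>
    then has exactly one negative factor, all earlier ones being positive.\<close>
  define m where "m = (LEAST n. \<rho>\<^sup>2 * q ^ n > 1)"
  have m: "\<rho>\<^sup>2 * q ^ m > 1"
    unfolding m_def by (rule LeastI[of "\<lambda>n. \<rho>\<^sup>2 * q ^ n > 1", OF ex])
  have less: "\<rho>\<^sup>2 * q ^ i < 1" if "i < m" for i
    using not_less_Least[of i "\<lambda>n. \<rho>\<^sup>2 * q ^ n > 1"] that ne[of i] unfolding m_def by linarith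
  have "asc_norm q \<rho> m > 0"
    unfolding asc_norm_def asc_coeff_def using less assms(1)
    by (intro prod_pos mult_pos_pos ballI) (auto intro!: q_number_Suc_pos)
  moreover have "asc_coeff q \<rho> m < 0"
    unfolding asc_coeff_def using m assms(1) by (intro mult_neg_pos q_number_Suc_pos) auto
  ultimately have "asc_norm q \<rho> (Suc m) < 0"
    by (simp add: asc_norm_def mult_pos_neg)
  with asc_norm_nonneg[of "Suc m"] show False by simp
qed

section \<open>Construction of a solution from two-point kernels\<close>

lemma q_hermite_uminus: "q_hermite q n (- x) = (- 1) ^ n * q_hermite q n x"
  by (induction n rule: induct_nat_012) (auto simp: algebra_simps)

text \<open>For \<open>\<rho>\<^sup>2 = 1/q\<close> the measure charges the two roots of \<open>P\<^sub>2\<close>, which lie on either side of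
  the mean \<open>\<rho> z\<close> because \<open>P\<^sub>2(\<rho> z) = \<rho>\<^sup>2 - 1 < 0\<close>. All \<open>P\<^sub>n\<close> with \<open>n \<ge> 2\<close> are multiples of \<open>P\<^sub>2\<close>.\<close>

lemma two_point_pmf:
  assumes "q > 1" "r\<^sup>2 = 1 / q"
  shows "\<exists>p :: real pmf. finite (set_pmf p) \<and>
    (\<forall>n. measure_pmf.expectation p (q_hermite q n) = r ^ n * q_hermite q n z)"
proof -
  \<comment> \<open>\<open>c\<close> is the required mean. Completing the square in
    \<open>P_2\<close> gives centre \<open>c (q + 1) / 2\<close> and half-distance \<open>D\<close>
    between the roots \<open>a\<close> and \<open>b\<close>.\<close>
  define c D where "c = r * z" and "D = sqrt ((c * (q - 1) / 2)\<^sup>2 + (1 - r\<^sup>2))"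
  define a b where "a = c * (q + 1) / 2 + D" and "b = c * (q + 1) / 2 - D"
  \<comment> \<open>Since \<open>a - b = 2 D\<close>, this is the weight of \<open>a\<close> that
    makes the mean equal to \<open>c\<close>.\<close>
  define w where "w = (c - b) / (2 * D)"
  have "r\<^sup>2 < 1"
    using assms by simp
  then have D2: "D\<^sup>2 = (c * (q - 1) / 2)\<^sup>2 + (1 - r\<^sup>2)"
    unfolding D_def by (intro real_sqrt_pow2) auto
  \<comment> \<open>The left side is the distance from \<open>c\<close> to the midpoint of the
    roots, so \<open>c\<close> lies strictly between them and \<open>w\<close> is a
    probability.\<close>
  have "\<bar>c * (q - 1) / 2\<bar> < D"
    unfolding D_def using \<open>r\<^sup>2 < 1\<close> by (intro real_less_rsqrt) (subst power2_abs, linarith)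
  then have D: "D > 0" "b < c" "c < a"
    by (auto simp: a_def b_def abs_less_iff field_simps)
  have w: "0 \<le> w" "w \<le> 1"
    using D by (auto simp: w_def field_simps a_def b_def)
  have mean: "w * a + (1 - w) * b = c"
    using D(1) by (simp add: w_def a_def b_def field_simps)
  define p where "p = map_pmf (\<lambda>t. if t then a else b) (bernoulli_pmf w)"
  have fin: "finite (set_pmf p)"
    by (simp add: p_def)
  have E: "measure_pmf.expectation p f = w * f a + (1 - w) * f b" for f :: "real \<Rightarrow> real"
    using w by (simp add: p_def)
  have root2: "poly (asc_poly q z r (Suc (Suc 0))) x = 0" if "x = a \<or> x = b" for x
  proof -
    have "poly (asc_poly q z r (Suc (Suc 0))) x = (x - c * (q + 1) / 2)\<^sup>2 - D\<^sup>2"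
      unfolding D2 by (simp add: asc_coeff_def c_def field_simps power2_eq_square)
    with that show ?thesis by (auto simp: a_def b_def)
  qed
  have root: "poly (asc_poly q z r (Suc (Suc n))) x = 0" if "x = a \<or> x = b" for x n
  proof (induction n rule: induct_nat_012)
    \<comment> \<open>The \<open>P_1\<close> term of \<open>P_3\<close> drops out because
      \<open>r^2 q = 1\<close>; from then on both predecessors vanish at the roots.\<close>
    case 1
    have "asc_coeff q r (Suc 0) = 0"
      using assms by (simp add: asc_coeff_def)
    then show ?case
      using root2[OF that] by (simp del: asc_poly.simps(2) add: asc_poly.simps(3)[of q z r "Suc 0"])
  qed (use root2[OF that] in auto)
  have "measure_pmf.expectation p (poly (asc_poly q z r n)) = 0" if "n \<ge> 1" for n
  proof (cases "n = 1")
    case True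
    then show ?thesis
      using mean by (simp add: E c_def algebra_simps)
  next
    case False
    with that have "n = Suc (Suc (n - 2))"
      by simp
    then obtain m where "n = Suc (Suc m)"
      by blast
    then show ?thesis
      by (simp add: E root del: asc_poly.simps)
  qed
  then have "measure_pmf.expectation p (q_hermite q n) = r ^ n * q_hermite q n z" if "n \<ge> 1" for n
    using that q_hermite_moments_iff_asc_poly_moments[of "measure_pmf p" q r z, OF prob_space_measure_pmf
        _ integrable_measure_pmf_finite[OF fin]] assms(1) by simp
  moreover have "measure_pmf.expectation p (q_hermite q 0) = 1"
    by (simp add: E)
  ultimately have "measure_pmf.expectation p (q_hermite q n) = r ^ n * q_hermite q n z" for n
    by (cases "n = 0") auto
  with fin show ?thesis by blast
qed

text \<open>The kernels compose like \<open>\<rho>\<^sub>1, \<rho>\<^sub>2 \<mapsto> \<rho>\<^sub>1 \<rho>\<^sub>2\<close> (Chapman--Kolmogorov), so \<open>m\<close> two-point steps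
  reach \<open>\<rho>\<^sup>2 = q\<^sup>-\<^sup>m\<close>.\<close>

lemma finite_pmf_solution:
  assumes "q > 1" "\<rho>\<^sup>2 = 1 / q ^ m"
  shows "\<exists>p :: real pmf. finite (set_pmf p) \<and>
    (\<forall>n. measure_pmf.expectation p (q_hermite q n) = \<rho> ^ n * q_hermite q n y)"
  using assms(2)
proof (induction m arbitrary: \<rho>)
  case 0
  then have "\<rho> = 1 \<or> \<rho> = - 1"
    by (simp add: power2_eq_1_iff)
  \<comment> \<open>A point mass at \<open>y\<close> or \<open>-y\<close>; parity of
    \<open>H_n\<close> covers \<open>\<rho> = -1\<close>.\<close>
  then show ?case
    by (intro exI[of _ "return_pmf (\<rho> * y)"]) (auto simp: q_hermite_uminus)
next
  case (Suc m)
  \<comment> \<open>The positive root is taken at every step, so the sign of \<open>\<rho>\<close>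
    is passed down to the base case.\<close>
  define r where "r = 1 / sqrt q"
  have r: "r\<^sup>2 = 1 / q" "r \<noteq> 0"
    using assms(1) by (auto simp: r_def power_divide)
  have "(\<rho> / r)\<^sup>2 = 1 / q ^ m"
    using Suc.prems r assms(1) by (simp add: power_divide)
  from Suc.IH[OF this] obtain p :: "real pmf" where p: "finite (set_pmf p)"
    "\<And>n. measure_pmf.expectation p (q_hermite q n) = (\<rho> / r) ^ n * q_hermite q n y"
    by blast
  obtain K :: "real \<Rightarrow> real pmf" where K: "\<And>z. finite (set_pmf (K z))"
    "\<And>z n. measure_pmf.expectation (K z) (q_hermite q n) = r ^ n * q_hermite q n z"
    using two_point_pmf[OF assms(1) r(1)] by metis
  \<comment> \<open>Integration against \<open>K z\<close> multiplies \<open>H_n(z)\<close> by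
    \<open>r^n\<close>, which completes \<open>(\<rho> / r)^n\<close> to
    \<open>\<rho>^n\<close>.\<close>
  have "measure_pmf.expectation (p \<bind> K) (q_hermite q n) = \<rho> ^ n * q_hermite q n y" for n
  proof -
    have "measure_pmf.expectation (p \<bind> K) (q_hermite q n) =
        (\<Sum>z\<in>set_pmf p. pmf p z *\<^sub>R (r ^ n * q_hermite q n z))"
      by (subst pmf_expectation_bind[OF p(1)]) (auto simp: K)
    also have "\<dots> = r ^ n * measure_pmf.expectation p (q_hermite q n)"
      by (subst integral_measure_pmf[OF p(1)]) (auto simp: sum_distrib_left algebra_simps)
    also have "\<dots> = \<rho> ^ n * q_hermite q n y"
      using r(2) by (simp add: p(2) power_divide)
    finally show ?thesis .
  qed
  moreover have "finite (set_pmf (p \<bind> K))"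
    using p(1) K(1) by simp
  ultimately show ?case by blast
qed

lemma q_hermite_moment_solution_exists:
  assumes "q > 1" "\<rho>\<^sup>2 = 1 / q ^ m"
  shows "\<exists>\<mu>. q_hermite_moment_solution q y \<rho> \<mu>"
proof -
  obtain p :: "real pmf" where p: "finite (set_pmf p)"
    "\<And>n. measure_pmf.expectation p (q_hermite q n) = \<rho> ^ n * q_hermite q n y"
    using finite_pmf_solution[OF assms] by blast
  \<comment> \<open>A pmf measures all subsets; pushing it forward along the identity gives the
    Borel sigma-algebra demanded of a \<open>real_distribution\<close>.\<close>
  define \<mu> where "\<mu> = distr (measure_pmf p) borel (\<lambda>x. x)"
  have "real_distribution \<mu>"
    unfolding \<mu>_def real_distribution_def real_distribution_axioms_def
    by (auto intro: measure_pmf.prob_space_distr)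
  moreover have "integrable \<mu> (\<lambda>x. x ^ k)" for k
    unfolding \<mu>_def by (subst integrable_distr_eq) (auto intro: integrable_measure_pmf_finite p(1))
  moreover have "q_hermite q n \<in> borel_measurable borel" for n
  proof (induction n rule: induct_nat_012)
    case (ge2 n)
    then show ?case
      by (simp add: q_hermite.simps[abs_def])
  qed simp_all
  then have "(\<integral>x. q_hermite q n x \<partial>\<mu>) = \<rho> ^ n * q_hermite q n y" for n
    unfolding \<mu>_def by (subst integral_distr) (auto simp: p(2))
  ultimately show ?thesis
    unfolding q_hermite_moment_solution_def by blast
qed

theorem corollary1:
  fixes q y \<rho> :: real
  assumes "q > 1"
  shows "(\<rho>\<^sup>2 \<notin> R_set q \<longrightarrow> \<not> (\<exists>\<mu>. q_hermite_moment_solution q y \<rho> \<mu>)) \<and>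
    (\<rho>\<^sup>2 \<in> R_set q \<and> \<rho>\<^sup>2 \<noteq> 0 \<longrightarrow>
      (\<exists>!\<mu>. q_hermite_moment_solution q y \<rho> \<mu>) \<and>
      (\<forall>\<mu>. q_hermite_moment_solution q y \<rho> \<mu> \<longrightarrow>
        (\<exists>S. discrete_supported_on \<mu> S \<and> real (card S) = 1 + log q (1 / \<rho>\<^sup>2))))"
proof (intro conjI impI)
  have "q > 0"
    using assms by simp
  note iff = q_hermite_moment_solution_iff[OF this]
  show "\<not> (\<exists>\<mu>. q_hermite_moment_solution q y \<rho> \<mu>)" if "\<rho>\<^sup>2 \<notin> R_set q"
    using not_asc_moments_if_notin_R_set[OF assms that] by (auto simp: iff)
  assume "\<rho>\<^sup>2 \<in> R_set q \<and> \<rho>\<^sup>2 \<noteq> 0"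
  then obtain m where m: "\<rho>\<^sup>2 = 1 / q ^ m"
    by (auto simp: R_set_def)
  note norm = asc_norm_degenerate[OF assms m]
  define Z where "Z = {x. poly (asc_poly q y \<rho> (Suc m)) x = 0}"
  have Z: "finite Z" "card Z \<le> Suc m"
    unfolding Z_def using card_poly_roots_bound[of "asc_poly q y \<rho> (Suc m)"]
      degree_asc_poly_le[of q y \<rho> "Suc m"] by (auto intro: poly_roots_finite)
  have AE_Z: "AE x in \<mu>. x \<in> Z" if "asc_moments \<mu> q y \<rho>" for \<mu>
    using asc_moments.AE_asc_poly_zero[OF that norm(1)] by (simp add: Z_def)
  show "\<exists>!\<mu>. q_hermite_moment_solution q y \<rho> \<mu>"
  proof (rule ex_ex1I)
    show "\<exists>\<mu>. q_hermite_moment_solution q y \<rho> \<mu>"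
      by (rule q_hermite_moment_solution_exists[OF assms m])
    show "\<mu> = \<nu>" if "q_hermite_moment_solution q y \<rho> \<mu>" "q_hermite_moment_solution q y \<rho> \<nu>" for \<mu> \<nu>
      using that unfolding iff
      by (intro real_distribution_eqI_finite[of \<mu> \<nu> Z] asc_moments_integral_unique AE_Z) (auto simp: Z)
  qed
  show "\<forall>\<mu>. q_hermite_moment_solution q y \<rho> \<mu> \<longrightarrow>
      (\<exists>S. discrete_supported_on \<mu> S \<and> real (card S) = 1 + log q (1 / \<rho>\<^sup>2))"
  proof (intro allI impI)
    fix \<mu> assume "q_hermite_moment_solution q y \<rho> \<mu>"
    then have rd: "real_distribution \<mu>" and am: "asc_moments \<mu> q y \<rho>"
      by (auto simp: iff)
    interpret real_distribution \<mu> by fact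
    \<comment> \<open>\<open>Z\<close> might contain null points; removing these finitely many
      leaves exactly the atoms.\<close>
    define S where "S = {z\<in>Z. measure \<mu> {z} > 0}"
    have "finite S" "S \<subseteq> Z"
      using Z(1) by (auto simp: S_def)
    have null: "AE x in \<mu>. x \<noteq> z" if "z \<in> Z - S" for z
    proof -
      have "measure \<mu> {z} = 0"
        using that measure_nonneg[of \<mu> "{z}"] by (auto simp: S_def order_less_le)
      then show ?thesis
        by (intro AE_I[of _ _ "{z}"]) (auto simp: emeasure_eq_measure)
    qed
    have "AE x in \<mu>. \<forall>z\<in>Z - S. x \<noteq> z"
      using null Z(1) by (intro AE_finite_allI) auto
    with AE_Z[OF am] have AE_S: "AE x in \<mu>. x \<in> S"
      by eventually_elim auto
    then have "measure \<mu> S = 1"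
      using \<open>finite S\<close> by (subst prob_eq_1) (auto simp: sets.countable countable_finite)
    then have "discrete_supported_on \<mu> S"
      using \<open>finite S\<close> by (auto simp: discrete_supported_on_def S_def)
    \<comment> \<open>At most \<open>m + 1\<close> by the degree of \<open>P_{m+1}\<close>, at least
      \<open>m + 1\<close> because the norms of index \<open>0\<close> to \<open>m\<close> are
      non-zero.\<close>
    moreover have "card S = Suc m"
      using asc_moments.card_carrier_ge[OF am \<open>finite S\<close> AE_S, of "Suc m"] norm(2)
        card_mono[OF Z(1) \<open>S \<subseteq> Z\<close>] Z(2) by (auto simp: less_Suc_eq_le)
    then have "real (card S) = 1 + log q (1 / \<rho>\<^sup>2)"
      using assms by (simp add: m log_nat_power)
    ultimately show "\<exists>S. discrete_supported_on \<mu> S \<and> real (card S) = 1 + log q (1 / \<rho>\<^sup>2)"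
      by blast
  qed
qed

end
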